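(* Let $n \ge 2$, let $X_1, X_2 \in \mathbb{R}^{n\times n}$, and define $f:\mathbb{R}^{n\times n}\to\mathbb{R}$ by $$f(X) := |X-X_1|^2\,|X-X_2|^2 .$$ Let $\sigma_1 \ge \sigma_2 \ge \cdots \ge \sigma_n \ge 0$ denote the singular values of the matrix difference $X_1 - X_2$. Then $f$ is polyconvex if and only if $$\sigma_1^2 + \sigma_2^2 + \cdots + \sigma_n^2 \ge 2\sigma_1^2 .$$
   Context: For $X \in \mathbb{R}^{n\times n}$, $|X|^2 = \mathrm{tr}(X^T X)$ denotes the squared Frobenius norm. Let $T:\mathbb{R}^{n\times n}\to\mathbb{R}^{\binom{2n}{n}-1}$ be the map returning the vector of all minors (subdeterminants of all orders $1,\dots,n$) of its matrix argument. A function $f:\mathbb{R}^{n\times n}\to\mathbb{R}$ is polyconvex if there is a convex function $h:\mathbb{R}^{\binom{2n}{n}-1}\to\mathbb{R}$ such that $f(X)=h(T(X))$ for all $X\in\mathbb{R}^{n\times n}$. *)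

theory Defs
  imports "HOL-Analysis.Analysis" "HOL-Computational_Algebra.Polynomial"
begin

(* The order on the index type only fixes the order of the rows and columns of a submatrix,
   and thereby the sign of a minor. *)
definition submatrix_det ::
    "real^'n::{finite,linorder}^'n::{finite,linorder} \<Rightarrow> 'n::{finite,linorder} set \<Rightarrow> 'n::{finite,linorder} set \<Rightarrow> real" where
  "submatrix_det A I J =
     (\<Sum>p | p permutes {..<card I}. of_int (sign p) *
        (\<Prod>i<card I. A $ (sorted_list_of_set I ! i) $ (sorted_list_of_set J ! p i)))"

typedef (overloaded) ('n::finite) minor_index =
    "{(I, J). I \<noteq> {} \<and> card I = card J} :: ('n set \<times> 'n set) set"
  morphisms minor_sets Abs_minor_index
  by (rule exI[of _ "(UNIV, UNIV)"]) auto

instance minor_index :: (finite) finite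
proof
  have "range (minor_sets :: 'a minor_index \<Rightarrow> _) \<subseteq> UNIV" by simp
  then have "finite (range (minor_sets :: 'a minor_index \<Rightarrow> _))"
    by (rule finite_subset) simp
  then show "finite (UNIV :: 'a minor_index set)"
    by (rule finite_imageD) (simp add: inj_def minor_sets_inject)
qed

lemma card_minor_index:
  "CARD('n::finite minor_index) = ((2 * CARD('n)) choose CARD('n)) - 1"
proof -
  let ?n = "CARD('n)"
  let ?P = "\<lambda>k. {I :: 'n set. card I = k}"
  have card_P: "card (?P k) = ?n choose k" for k
    using n_subsets[of "UNIV :: 'n set" k] by simp
  have "CARD('n minor_index) = card {(I, J). I \<noteq> {} \<and> card (I :: 'n set) = card (J :: 'n set)}"
    using type_definition.card[OF type_definition_minor_index] .
  also have "{(I, J). I \<noteq> {} \<and> card (I :: 'n set) = card (J :: 'n set)}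
      = (\<Union>k\<in>{1..?n}. ?P k \<times> ?P k)"
    by (auto simp: Suc_le_eq card_gt_0_iff card_mono)
  also have "card \<dots> = (\<Sum>k\<in>{1..?n}. card (?P k \<times> ?P k))"
    by (rule card_UN_disjoint) auto
  also have "\<dots> = (\<Sum>k\<in>{1..?n}. (?n choose k)\<^sup>2)"
    by (simp add: card_cartesian_product card_P power2_eq_square)
  also have "\<dots> = (\<Sum>k\<le>?n. (?n choose k)\<^sup>2) - 1"
    by (simp add: atMost_atLeast0 sum.atLeast_Suc_atMost[of 0])
  finally show ?thesis by (simp add: choose_square_sum)
qed

definition minors ::
    "real^'n::{finite,linorder}^'n::{finite,linorder} \<Rightarrow> real^('n::{finite,linorder} minor_index)" where
  "minors A = (\<chi> k. case minor_sets k of (I, J) \<Rightarrow> submatrix_det A I J)"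

definition polyconvex ::
    "(real^'n::{finite,linorder}^'n::{finite,linorder} \<Rightarrow> real) \<Rightarrow> bool" where
  "polyconvex f \<longleftrightarrow>
     (\<exists>h :: real^('n minor_index) \<Rightarrow> real. convex_on UNIV h \<and> (\<forall>X. f X = h (minors X)))"

definition frobenius_sq :: "real^'n^'n \<Rightarrow> real" where
  "frobenius_sq X = trace (transpose X ** X)"

definition charpoly :: "real^'n^'n \<Rightarrow> real poly" where
  "charpoly A = det (\<chi> i j. (if i = j then [:0, 1:] else 0) - [:A $ i $ j:])"

(* Square roots of the eigenvalues of transpose A ** A, listed in decreasing order and with
   algebraic multiplicity.  The characteristic polynomial of a real symmetric matrix splits
   over the reals, so the list has length CARD('n). *)
definition singular_values :: "real^'n^'n \<Rightarrow> real list" where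
  "singular_values A =
     rev (sorted_list_of_multiset (image_mset sqrt (proots (charpoly (transpose A ** A)))))"

end

theory Submission
  imports Defs
begin

text \<open>
  Let \<open>D = X1 - X2\<close>, let \<open>C\<close> be the midpoint of \<open>X1\<close> and \<open>X2\<close>, and put \<open>Z = X - C\<close> and
  \<open>s = D \<bullet> D\<close>, where \<open>\<bullet>\<close> is the Frobenius inner product.  Then
  \<open>f X = (Z \<bullet> Z + s / 4)\<^sup>2 - (D \<bullet> Z)\<^sup>2\<close>, and the only obstruction to convexity is the negative
  square.  Both directions pass through the operator bound
  \<open>2 * norm (D *v v)\<^sup>2 \<le> s * norm v\<^sup>2\<close> for all \<open>v\<close>.

  The bound is sufficient because polyconvex functions may be changed by arbitrary linear
  combinations of minors.  Pairing the minors of order two of \<open>D\<close> with those of \<open>Z\<close> replaces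
  \<open>(D \<bullet> Z)\<^sup>2\<close> by the trace of the square of \<open>D ** transpose Z\<close> (\<open>minor_pairing\<close>).
  This trace is at most the squared Frobenius norm of \<open>D ** transpose Z\<close>, which the operator bound
  controls by \<open>s / 2 * (Z \<bullet> Z)\<close>.  What is left is a nonnegative quadratic form plus
  \<open>(Z \<bullet> Z)\<^sup>2\<close> and a constant, hence convex (\<open>polyconvex_if_operator_bound\<close>).

  The bound is necessary because minors are affine along rank-one lines
  (\<open>minors_rank_one_midpoint\<close>), so that a polyconvex function is convex along such lines.  At \<open>Z = 0\<close>, in the
  direction of the outer product of \<open>D *v v\<close> and \<open>v\<close>, the second-order terms of \<open>f\<close> give exactly the bound
  (\<open>operator_bound_if_polyconvex\<close>).

  Finally, the spectral theorem for the Gram matrix \<open>transpose D ** D\<close> identifies \<open>s\<close> with the sum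
  of the squared singular values and the squared operator norm of \<open>D\<close> with the largest of them
  (\<open>operator_bound_iff_singular_values\<close>).
\<close>

section \<open>Convex quadratic forms\<close>

text \<open>
  The defect in the convexity inequality between \<open>x\<close> and \<open>y\<close> is
  \<open>t * (1 - t)\<close> times the form evaluated at \<open>x - y\<close>, so nonnegativity of the form suffices.
\<close>

lemma convex_on_bilinear_diagonal:
  fixes B :: "'a::real_vector \<Rightarrow> 'a \<Rightarrow> real"
  assumes B: "bilinear B" and nonneg: "\<And>z. 0 \<le> B z z"
  shows "convex_on UNIV (\<lambda>x. B (x - c) (x - c))"
proof (rule convex_onI)
  fix t :: real and x y :: 'a
  assume t: "0 < t" "t < 1"
  let ?x = "x - c" and ?y = "y - c"
  have split: "(1 - t) *\<^sub>R x + t *\<^sub>R y - c = (1 - t) *\<^sub>R ?x + t *\<^sub>R ?y"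
    by (simp add: algebra_simps)
  have "(1 - t) * B ?x ?x + t * B ?y ?y - B ((1 - t) *\<^sub>R ?x + t *\<^sub>R ?y) ((1 - t) *\<^sub>R ?x + t *\<^sub>R ?y)
      = t * (1 - t) * B (?x - ?y) (?x - ?y)"
    unfolding bilinear_ladd[OF B] bilinear_radd[OF B] bilinear_lmul[OF B] bilinear_rmul[OF B]
      bilinear_lsub[OF B, of ?x ?y] bilinear_rsub[OF B, of _ ?x ?y]
    by (simp add: algebra_simps)
  also have "\<dots> \<ge> 0"
    using t nonneg by simp
  finally show "B ((1 - t) *\<^sub>R x + t *\<^sub>R y - c) ((1 - t) *\<^sub>R x + t *\<^sub>R y - c)
      \<le> (1 - t) * B ?x ?x + t * B ?y ?y"
    unfolding split by simp
qed simp

lemma convex_on_power2_nonneg: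
  fixes g :: "'a::real_vector \<Rightarrow> real"
  assumes "convex_on S g" and nonneg: "\<And>x. x \<in> S \<Longrightarrow> 0 \<le> g x"
  shows "convex_on S (\<lambda>x. (g x)\<^sup>2)"
proof (rule convex_onI)
  show "convex S"
    using assms(1) by (rule convex_on_imp_convex)
  fix t :: real and x y
  assume t: "0 < t" "t < 1" and xy: "x \<in> S" "y \<in> S"
  let ?z = "(1 - t) *\<^sub>R x + t *\<^sub>R y"
  have "?z \<in> S"
    using \<open>convex S\<close> t xy by (simp add: convex_alt)
  then have "(g ?z)\<^sup>2 \<le> ((1 - t) * g x + t * g y)\<^sup>2"
    using t xy by (intro power_mono nonneg convex_onD[OF assms(1)]) auto
  also have "\<dots> \<le> (1 - t) * (g x)\<^sup>2 + t * (g y)\<^sup>2"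
    using convex_onD[OF convex_power2, of t "g x" "g y"] t by simp
  finally show "(g ?z)\<^sup>2 \<le> (1 - t) * (g x)\<^sup>2 + t * (g y)\<^sup>2" .
qed

lemma frobenius_sq_eq_inner: "frobenius_sq X = X \<bullet> X"
proof -
  have "frobenius_sq X = (\<Sum>j\<in>UNIV. \<Sum>i\<in>UNIV. X$i$j * X$i$j)"
    by (simp add: frobenius_sq_def trace_def matrix_matrix_mult_def transpose_def)
  also have "\<dots> = X \<bullet> X"
    by (subst sum.swap) (simp add: inner_vec_def)
  finally show ?thesis .
qed

section \<open>Closure properties of polyconvex functions\<close>

lemma minors_nth:
  assumes "I \<noteq> {}" "card I = card J"
  shows "minors X $ Abs_minor_index (I, J) = submatrix_det X I J"
  using assms by (simp add: minors_def Abs_minor_index_inverse)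

lemma submatrix_det_singleton: "submatrix_det X {i} {j} = X $ i $ j"
proof -
  have "{p. p permutes {..<Suc 0}} = {id}"
    by (auto simp: lessThan_Suc)
  then show ?thesis
    by (simp add: submatrix_det_def)
qed

lemma submatrix_det_two:
  assumes "i < k" "j < l"
  shows "submatrix_det X {i, k} {j, l} = X $ i $ j * X $ k $ l - X $ i $ l * X $ k $ j"
proof -
  have "sorted_list_of_set {i, k} = [i, k]" "sorted_list_of_set {j, l} = [j, l]"
    using assms by (auto simp: sorted_list_of_set_insert_remove)
  moreover have "card {i, k} = 2"
    using assms by auto
  moreover have "{..<2::nat} = insert 0 {1}"
    by auto
  ultimately show ?thesis
    unfolding submatrix_det_def
    by (simp add: sum_over_permutations_insert sign_swap_id sign_compose permutation_swap_id)
qed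

text \<open>
  The minors of order one are the entries, so \<open>X\<close> is a linear function of its vector of minors.
\<close>

lemma convex_on_imp_polyconvex:
  fixes f :: "real^'n::{finite,linorder}^'n::{finite,linorder} \<Rightarrow> real"
  assumes "convex_on UNIV f"
  shows "polyconvex f"
proof -
  define E :: "real^('n::{finite,linorder} minor_index) \<Rightarrow> real^'n::{finite,linorder}^'n::{finite,linorder}"
    where "E v = (\<chi> i j. v $ Abs_minor_index ({i}, {j}))" for v
  have E: "E (minors X) = X" for X
    by (simp add: E_def minors_nth submatrix_det_singleton vec_eq_iff)
  have lin: "E ((1 - t) *\<^sub>R v + t *\<^sub>R w) = (1 - t) *\<^sub>R E v + t *\<^sub>R E w" for t v w
    by (simp add: E_def vec_eq_iff)
  have "convex_on UNIV (\<lambda>v. f (E v))"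
    using assms by (intro convex_onI) (auto simp: lin intro: convex_onD)
  then show ?thesis
    unfolding polyconvex_def by (intro exI[of _ "\<lambda>v. f (E v)"]) (simp add: E)
qed

lemma polyconvex_const: "polyconvex (\<lambda>X. c)"
  by (intro convex_on_imp_polyconvex) (simp add: convex_on_const)

lemma polyconvex_add:
  assumes "polyconvex f" "polyconvex g"
  shows "polyconvex (\<lambda>X. f X + g X)"
proof -
  obtain h k where "convex_on UNIV h" "\<And>X. f X = h (minors X)"
      and "convex_on UNIV k" "\<And>X. g X = k (minors X)"
    using assms unfolding polyconvex_def by blast
  then show ?thesis
    unfolding polyconvex_def
    by (intro exI[of _ "\<lambda>v. h v + k v"]) (simp add: convex_on_add)
qed

lemma polyconvex_sum:
  assumes "\<And>a. a \<in> S \<Longrightarrow> polyconvex (f a)"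
  shows "polyconvex (\<lambda>X. \<Sum>a\<in>S. f a X)"
  using assms
proof (induction S rule: infinite_finite_induct)
  case (insert a S)
  have "polyconvex (\<lambda>X. f a X + (\<Sum>a\<in>S. f a X))"
    using insert by (intro polyconvex_add[of "f a"]) auto
  then show ?case
    using insert.hyps by simp
qed (simp_all add: polyconvex_const)

lemma polyconvex_minor:
  assumes "I \<noteq> {}" "card I = card J"
  shows "polyconvex (\<lambda>X. c * submatrix_det X I J)"
proof -
  have "convex_on UNIV (\<lambda>v. c * v $ Abs_minor_index (I, J))"
    by (rule convex_onI) (simp_all add: algebra_simps)
  then show ?thesis
    unfolding polyconvex_def
    by (intro exI[of _ "\<lambda>v. c * v $ Abs_minor_index (I, J)"]) (simp add: minors_nth[OF assms])
qed

text \<open>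
  As a function of \<open>X\<close> the expression is, up to sign, the minor with rows \<open>i, k\<close> and columns
  \<open>j, l\<close>, or it vanishes when two rows or two columns coincide.  Because minors enter with
  coefficients of either sign, the sign that depends on the order of the indices is absorbed
  into \<open>c\<close>.
\<close>

lemma polyconvex_two_by_two:
  "polyconvex (\<lambda>X. c * (X $ i $ j * X $ k $ l - X $ i $ l * X $ k $ j))" (is "polyconvex (?m c i j k l)")
proof -
  have ordered: "polyconvex (?m c i j k l)" if "i < k" "j < l" for c i j k l
    using polyconvex_minor[of "{i, k}" "{j, l}" c] that
    by (simp add: submatrix_det_two)
  consider "i = k \<or> j = l" | "i < k" "j < l" | "i < k" "l < j" | "k < i" "j < l" | "k < i" "l < j"
    by force
  then show ?thesis
  proof cases
    case 1
    then have "?m c i j k l = (\<lambda>X. 0)"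
      by auto
    then show ?thesis
      using polyconvex_const[of 0] by simp
  next
    case 2
    then show ?thesis
      by (rule ordered)
  next
    case 3
    have "?m c i j k l = ?m (- c) i l k j"
      by (auto simp: algebra_simps)
    then show ?thesis
      using ordered[OF 3] by (simp only:)
  next
    case 4
    have "?m c i j k l = ?m (- c) k j i l"
      by (auto simp: algebra_simps)
    then show ?thesis
      using ordered[OF 4] by (simp only:)
  next
    case 5
    have "?m c i j k l = ?m c k l i j"
      by (auto simp: algebra_simps)
    then show ?thesis
      using ordered[OF 5] by (simp only:)
  qed
qed

text \<open>
  Translating the argument changes a minor of order two only by an affine function of \<open>X\<close>.
\<close>

lemma polyconvex_two_by_two_translate:
  "polyconvex (\<lambda>X. c * ((X - C) $ i $ j * (X - C) $ k $ l - (X - C) $ i $ l * (X - C) $ k $ j))"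
proof -
  define L where "L X = c * ((C $ i $ j * C $ k $ l - C $ i $ l * C $ k $ j)
      - (C $ i $ j * X $ k $ l + X $ i $ j * C $ k $ l - C $ i $ l * X $ k $ j - X $ i $ l * C $ k $ j))"
    for X :: "real^'a::{finite,linorder}^'a::{finite,linorder}"
  have "convex_on UNIV L"
    by (rule convex_onI) (simp_all add: L_def algebra_simps)
  then have "polyconvex (\<lambda>X. c * (X $ i $ j * X $ k $ l - X $ i $ l * X $ k $ j) + L X)"
    by (rule polyconvex_add[OF polyconvex_two_by_two convex_on_imp_polyconvex])
  then show ?thesis
    by (simp add: L_def algebra_simps)
qed

section \<open>Polyconvexity along rank-one lines\<close>

text \<open>
  Composition with a transposition reverses the sign of a permutation; a function that does not
  notice the transposition therefore has a signed sum equal to its own negative.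
\<close>

lemma sum_permutes_sign_symmetric_eq_0:
  fixes f :: "('a \<Rightarrow> 'a) \<Rightarrow> real"
  assumes "finite A" "i \<in> A" "j \<in> A" "i \<noteq> j"
    and swap: "\<And>p. p permutes A \<Longrightarrow> f (p \<circ> Transposition.transpose i j) = f p"
  shows "(\<Sum>p | p permutes A. of_int (sign p) * f p) = 0"
proof -
  let ?s = "Transposition.transpose i j"
  have s: "?s permutes A"
    using assms by (simp add: permutes_swap_id)
  have "(\<Sum>p | p permutes A. of_int (sign p) * f p)
      = (\<Sum>p | p permutes A. of_int (sign (p \<circ> ?s)) * f (p \<circ> ?s))"
    by (rule sum_permutations_compose_right[OF s])
  also have "\<dots> = (\<Sum>p | p permutes A. - (of_int (sign p) * f p))"
  proof (rule sum.cong[OF refl])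
    fix p assume "p \<in> {p. p permutes A}"
    then have p: "p permutes A" by simp
    have "sign (p \<circ> ?s) = - sign p"
      using p s assms by (simp add: sign_compose permutes_imp_permutation[OF \<open>finite A\<close>] sign_swap_id)
    then show "of_int (sign (p \<circ> ?s)) * f (p \<circ> ?s) = - (of_int (sign p) * f p)"
      using swap[OF p] by simp
  qed
  finally show ?thesis
    by (simp add: sum_negf)
qed

text \<open>
  Minors are affine along lines in a rank-one direction.  Expand the product in the Leibniz
  formula for \<open>C + e *\<^sub>R R\<close> over the set \<open>S\<close> of rows in which the factor comes from \<open>R\<close>.  If
  \<open>S\<close> contains two rows, swapping the columns assigned to them permutes the factors
  \<open>b $ j\<close> and changes nothing else, so the signed sum over permutations vanishes.  What remains is of degree at
  most one in \<open>e\<close>, and the values at \<open>e = 1\<close> and \<open>e = -1\<close> average to the value at \<open>0\<close>.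
\<close>

lemma minors_rank_one_midpoint:
  fixes C :: "real^'n::{finite,linorder}^'n::{finite,linorder}" and a b :: "real^'n::{finite,linorder}"
  defines "R \<equiv> \<chi> i j. a $ i * b $ j"
  shows "minors (C + R) + minors (C - R) = 2 *\<^sub>R minors C"
proof -
  have "submatrix_det (C + R) I J + submatrix_det (C - R) I J = 2 * submatrix_det C I J" for I J
  proof -
    let ?N = "{..<card I}" and ?I = "\<lambda>i. sorted_list_of_set I ! i" and ?J = "\<lambda>i. sorted_list_of_set J ! i"
    \<comment> \<open>\<open>c S\<close> collects the terms whose factors from \<open>R\<close> are those in the rows \<open>S\<close>.\<close>
    define c where "c S = (\<Sum>p | p permutes ?N. of_int (sign p) *
      ((\<Prod>i\<in>S. R $ ?I i $ ?J (p i)) * (\<Prod>i\<in>?N-S. C $ ?I i $ ?J (p i))))" for S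
    have expand: "submatrix_det (C + e *\<^sub>R R) I J = (\<Sum>S\<in>Pow ?N. e ^ card S * c S)" for e :: real
    proof -
      have "submatrix_det (C + e *\<^sub>R R) I J = (\<Sum>p | p permutes ?N. of_int (sign p) *
         (\<Prod>i\<in>?N. e * R $ ?I i $ ?J (p i) + C $ ?I i $ ?J (p i)))"
        by (simp add: submatrix_det_def add.commute)
      also have "\<dots> = (\<Sum>p | p permutes ?N. \<Sum>S\<in>Pow ?N. e ^ card S * (of_int (sign p) *
         ((\<Prod>i\<in>S. R $ ?I i $ ?J (p i)) * (\<Prod>i\<in>?N-S. C $ ?I i $ ?J (p i)))))"
        by (simp add: prod_add prod.distrib sum_distrib_left mult_ac)
      also have "\<dots> = (\<Sum>S\<in>Pow ?N. e ^ card S * c S)"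
        unfolding c_def sum_distrib_left by (rule sum.swap)
      finally show ?thesis .
    qed
    have c0: "c S = 0" if S: "S \<subseteq> ?N" "card S \<ge> 2" for S
    proof -
      obtain i j where ij: "i \<in> S" "j \<in> S" "i \<noteq> j"
        using S(2) by (meson card_2_iff' ex_card in_mono obtain_subset_with_card_n)
      let ?s = "Transposition.transpose i j"
      have s: "?s permutes S"
        using ij by (simp add: permutes_swap_id)
      have "(\<Prod>x\<in>S. R $ ?I x $ ?J (p (?s x))) = (\<Prod>x\<in>S. R $ ?I x $ ?J (p x))" for p
      proof -
        have "(\<Prod>x\<in>S. b $ ?J (p (?s x))) = (\<Prod>x\<in>S. b $ ?J (p x))"
          using prod.permute[OF s, of "\<lambda>x. b $ ?J (p x)"] by (simp add: o_def)
        then show ?thesis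
          by (simp add: R_def prod.distrib)
      qed
      moreover have "(\<Prod>x\<in>?N-S. C $ ?I x $ ?J (p (?s x))) = (\<Prod>x\<in>?N-S. C $ ?I x $ ?J (p x))" for p
        using ij by (intro prod.cong) (auto simp: Transposition.transpose_def)
      ultimately show ?thesis
        unfolding c_def
        using ij S(1) by (intro sum_permutes_sign_symmetric_eq_0[of _ i j]) auto
    qed
    \<comment> \<open>The power \<open>0 ^ card S\<close> selects \<open>S = {}\<close>, where \<open>0 ^ 0 = 1\<close>; singletons cancel on the left.\<close>
    have "(1 ^ card S + (-1) ^ card S) * c S = 2 * (0 ^ card S * c S)" if "S \<subseteq> ?N" for S
    proof -
      consider "card S = 0" | "card S = 1" | "card S \<ge> 2" by linarith
      then show ?thesis
        using c0[OF that] by cases auto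
    qed
    then have "(\<Sum>S\<in>Pow ?N. 1 ^ card S * c S) + (\<Sum>S\<in>Pow ?N. (-1) ^ card S * c S)
        = 2 * (\<Sum>S\<in>Pow ?N. 0 ^ card S * c S)"
      unfolding sum.distrib[symmetric] sum_distrib_left
      by (intro sum.cong) (auto simp: distrib_right)
    then show ?thesis
      using expand[of 1] expand[of "-1"] expand[of 0] by simp
  qed
  then show ?thesis
    by (simp add: vec_eq_iff minors_def split: prod.split)
qed

text \<open>
  This is the classical fact that polyconvexity implies rank-one convexity, in midpoint form.
\<close>

lemma polyconvex_rank_one_midpoint:
  fixes C :: "real^'n::{finite,linorder}^'n::{finite,linorder}" and a b :: "real^'n::{finite,linorder}"
  assumes "polyconvex f"
  defines "R \<equiv> \<chi> i j. a $ i * b $ j"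
  shows "2 * f C \<le> f (C + R) + f (C - R)"
proof -
  obtain h where h: "convex_on UNIV h" "\<And>X. f X = h (minors X)"
    using assms(1) unfolding polyconvex_def by blast
  have "minors C = (1/2) *\<^sub>R (minors (C + R) + minors (C - R))"
    unfolding minors_rank_one_midpoint[of C a b, folded R_def] by simp
  then have mid: "minors C = (1 - 1/2) *\<^sub>R minors (C + R) + (1/2) *\<^sub>R minors (C - R)"
    by (simp add: scaleR_add_right)
  show ?thesis
    using convex_onD[OF h(1), of "1/2" "minors (C + R)" "minors (C - R)"]
    unfolding mid[symmetric] h(2)[symmetric] by simp
qed

section \<open>Eigenvalues of symmetric matrices\<close>

text \<open>
  A maximizer \<open>v\<close> of the quadratic form of \<open>A\<close> on the unit sphere of \<open>S\<close> is an eigenvector: with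
  \<open>\<mu>\<close> the maximum, the form \<open>\<mu> * (w \<bullet> w) - w \<bullet> (A *v w)\<close> is nonnegative on \<open>S\<close> and vanishes at
  \<open>v\<close>, so its first variation at \<open>v\<close> in the direction of the residual \<open>r = \<mu> *\<^sub>R v - A *v v\<close>
  has to vanish as well, and this variation is a multiple of \<open>r \<bullet> r\<close>.
\<close>

lemma symmetric_eigenvector_in_subspace:
  fixes A :: "real^'n^'n"
  assumes sym: "\<And>x y. x \<bullet> (A *v y) = (A *v x) \<bullet> y"
    and S: "subspace S" "\<And>x. x \<in> S \<Longrightarrow> A *v x \<in> S" and x0: "x0 \<in> S" "x0 \<noteq> 0"
  obtains v \<mu> where "v \<in> S" "norm v = 1" "A *v v = \<mu> *\<^sub>R v"
proof -
  let ?K = "S \<inter> sphere 0 1"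
  have "compact ?K"
    using S(1) by (simp add: closed_Int_compact closed_subspace)
  moreover have "x0 /\<^sub>R norm x0 \<in> ?K"
    using x0 S(1) by (simp add: subspace_scale)
  moreover have "continuous_on ?K (\<lambda>v. v \<bullet> (A *v v))"
    by (intro continuous_intros matrix_vector_mult_linear_continuous_on)
  ultimately obtain v where v: "v \<in> ?K" and max: "\<And>w. w \<in> ?K \<Longrightarrow> w \<bullet> (A *v w) \<le> v \<bullet> (A *v v)"
    using continuous_attains_sup[of ?K "\<lambda>v. v \<bullet> (A *v v)"] by blast
  define \<mu> where "\<mu> = v \<bullet> (A *v v)"
  have nonneg: "0 \<le> \<mu> * (w \<bullet> w) - w \<bullet> (A *v w)" if "w \<in> S" for w
  proof (cases "w = 0")
    case False
    have "(w /\<^sub>R norm w) \<bullet> (A *v (w /\<^sub>R norm w)) \<le> \<mu>"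
      unfolding \<mu>_def using False that S(1) by (intro max) (simp add: subspace_scale)
    then have "(w \<bullet> (A *v w)) / (norm w)\<^sup>2 \<le> \<mu>"
      by (simp add: matrix_vector_mult_scaleR power2_eq_square divide_inverse mult_ac)
    then show ?thesis
      using False by (simp add: pos_divide_le_eq power2_norm_eq_inner)
  qed (simp add: matrix_vector_mult_0_right)
  define r where "r = \<mu> *\<^sub>R v - A *v v"
  have "v \<in> S" and vv: "v \<bullet> v = 1"
    using v by (auto simp: norm_eq_1)
  have "r \<in> S"
    unfolding r_def using \<open>v \<in> S\<close> S by (intro subspace_diff subspace_scale) auto
  have "0 \<le> 2 * t * (r \<bullet> r) + t\<^sup>2 * (\<mu> * (r \<bullet> r) - r \<bullet> (A *v r))" for t
  proof -
    have "v + t *\<^sub>R r \<in> S"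
      using \<open>v \<in> S\<close> \<open>r \<in> S\<close> S(1) by (intro subspace_add subspace_scale)
    from nonneg[OF this]
    have "0 \<le> \<mu> * ((v + t *\<^sub>R r) \<bullet> (v + t *\<^sub>R r)) - (v + t *\<^sub>R r) \<bullet> (A *v (v + t *\<^sub>R r))" .
    also have "\<dots> = 2 * t * (\<mu> * (v \<bullet> r) - (A *v v) \<bullet> r) + t\<^sup>2 * (\<mu> * (r \<bullet> r) - r \<bullet> (A *v r))"
      using vv sym[of v r]
      by (simp add: matrix_vector_right_distrib matrix_vector_mult_scaleR inner_add_left inner_add_right
          inner_commute[of r v] inner_commute[of r "A *v v"] \<mu>_def power2_eq_square algebra_simps)
    also have "\<mu> * (v \<bullet> r) - (A *v v) \<bullet> r = r \<bullet> r"
      by (simp add: r_def inner_diff_left)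
    finally show ?thesis .
  qed
  note quad = this
  have "r \<bullet> r = 0"
  proof (rule ccontr)
    assume "r \<bullet> r \<noteq> 0"
    then have pos: "r \<bullet> r > 0" by simp
    define q where "q = \<mu> * (r \<bullet> r) - r \<bullet> (A *v r)"
    have "0 \<le> q" unfolding q_def by (rule nonneg[OF \<open>r \<in> S\<close>])
    \<comment> \<open>The parabola in \<open>quad\<close> has its vertex at \<open>- (r \<bullet> r) / q\<close>; \<open>q + 1\<close> in place of \<open>q\<close> covers \<open>q = 0\<close> and still gives a negative value.\<close>
    define m where "m = (r \<bullet> r) / (q + 1)"
    have "m > 0" and rr: "r \<bullet> r = m * (q + 1)"
      using \<open>0 \<le> q\<close> pos by (simp_all add: m_def)
    have "2 * (- m) * (r \<bullet> r) + (- m)\<^sup>2 * q = - (m\<^sup>2 * (q + 2))"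
      unfolding rr by (simp add: power2_eq_square algebra_simps)
    also have "\<dots> < 0"
      using \<open>0 \<le> q\<close> \<open>m > 0\<close> by simp
    finally show False
      using quad[of "- m"] by (simp add: q_def)
  qed
  then have "A *v v = \<mu> *\<^sub>R v"
    by (simp add: r_def)
  then show thesis
    using that \<open>v \<in> S\<close> v by auto
qed

text \<open>
  Spectral theorem.  An orthonormal set of eigenvectors of maximal cardinality is a basis: its
  orthogonal complement is invariant under the symmetric matrix \<open>A\<close>, and if it were nonzero, it
  would contain a further unit eigenvector.
\<close>

theorem symmetric_orthonormal_eigenbasis:
  fixes A :: "real^'n^'n"
  assumes symA: "transpose A = A"
  obtains e :: "'n \<Rightarrow> real^'n" and \<mu>
  where "\<And>i j. e i \<bullet> e j = (if i = j then 1 else 0)" "\<And>i. A *v e i = \<mu> i *\<^sub>R e i"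
proof -
  have sym: "x \<bullet> (A *v y) = (A *v x) \<bullet> y" for x y
    using dot_lmul_matrix[of x A y] transpose_matrix_vector[of A x] symA by simp
  define good where "good B \<longleftrightarrow> pairwise orthogonal B \<and> (\<forall>v\<in>B. norm v = 1 \<and> (\<exists>c. A *v v = c *\<^sub>R v))"
    for B :: "(real^'n) set"
  have indep: "independent B" if "good B" for B
    using that unfolding good_def by (intro pairwise_orthogonal_independent) auto
  have card_le: "card B \<le> CARD('n)" if "good B" for B
    using independent_card_le_dim[OF subset_UNIV indep[OF that]] by (simp add: dim_UNIV)
  have "good {}"
    by (simp add: good_def)
  then obtain B where B: "good B" and maxB: "\<And>B'. good B' \<Longrightarrow> card B' \<le> card B"
    using ex_has_greatest_nat[of good "{}" card "Suc CARD('n)"] card_le by (auto simp: less_Suc_eq_le)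
  have finB: "finite B"
    using indep[OF B] independent_imp_finite by blast
  have "card B = CARD('n)"
  proof (rule ccontr)
    assume "card B \<noteq> CARD('n)"
    then have "dim B < DIM(real^'n)"
      using card_le[OF B] dim_eq_card_independent[OF indep[OF B]] by simp
    then obtain x where x: "x \<noteq> 0" "\<And>y. y \<in> span B \<Longrightarrow> orthogonal x y"
      by (rule orthogonal_to_subspace_exists) auto
    let ?S = "{y. \<forall>b\<in>B. orthogonal b y}"
    have inv: "A *v y \<in> ?S" if "y \<in> ?S" for y
      using B that by (auto simp: good_def orthogonal_def sym)
    have "x \<in> ?S"
      using x(2) span_base by (auto simp: orthogonal_commute)
    obtain v c where v: "v \<in> ?S" "norm v = 1" "A *v v = c *\<^sub>R v"
      by (rule symmetric_eigenvector_in_subspace[of A ?S x, OF sym subspace_orthogonal_to_vectors inv \<open>x \<in> ?S\<close> x(1)])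
    have "v \<notin> B"
      using v by (auto simp: orthogonal_def norm_eq_1)
    moreover have "good (insert v B)"
      using B v unfolding good_def by (auto simp: pairwise_insert orthogonal_commute)
    ultimately show False
      using maxB[of "insert v B"] finB by simp
  qed
  then have "\<exists>e. bij_betw e (UNIV :: 'n set) B"
    using finB by (intro finite_same_card_bij) simp_all
  then obtain e where e: "bij_betw e (UNIV :: 'n set) B"
    by blast
  have eB: "e i \<in> B" for i
    using e by (auto simp: bij_betw_def)
  have "\<forall>i. \<exists>c. A *v e i = c *\<^sub>R e i"
    using B eB unfolding good_def by blast
  then have "\<exists>\<mu>. \<forall>i. A *v e i = \<mu> i *\<^sub>R e i"
    by (rule choice)
  then obtain \<mu> where eig: "\<And>i. A *v e i = \<mu> i *\<^sub>R e i"
    by blast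
  have "e i \<bullet> e j = (if i = j then 1 else 0)" for i j
  proof (cases "i = j")
    case True
    then show ?thesis using B eB by (auto simp: good_def norm_eq_1)
  next
    case False
    then have "e i \<noteq> e j"
      using e by (auto simp: bij_betw_def inj_def)
    then show ?thesis
      using B eB False by (auto simp: good_def pairwise_def orthogonal_def)
  qed
  then show thesis
    using eig by (rule that)
qed

text \<open>
  The usual computation \<open>x - Q A P = Q (x - A) P\<close> takes place over the polynomial ring, into which
  real matrices are embedded entrywise as constant polynomials by \<open>K\<close>.
\<close>

lemma charpoly_similar:
  fixes A P Q :: "real^'n^'n"
  assumes "Q ** P = mat 1"
  shows "charpoly (Q ** A ** P) = charpoly A"
proof -
  define K :: "real^'n^'n \<Rightarrow> real poly^'n^'n" where "K M = (\<chi> i j. [:M $ i $ j:])" for M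
  define x where "x = (mat [:0, 1:] :: real poly^'n^'n)"
  have sum_const: "(\<Sum>i\<in>S. [:f i:]) = [:\<Sum>i\<in>S. f i:]" for f :: "'n \<Rightarrow> real" and S
    by (induction S rule: infinite_finite_induct) auto
  have K_mult: "K (M ** N) = K M ** K N" for M N
    by (simp add: K_def matrix_matrix_mult_def vec_eq_iff sum_const) (simp add: mult.commute)
  have K_1: "K (mat 1) = mat 1"
    by (auto simp: K_def mat_def vec_eq_iff)
  have charpoly_K: "charpoly M = det (x - K M)" for M
    unfolding charpoly_def
    by (rule arg_cong[where f = det]) (simp add: x_def K_def mat_def vec_eq_iff)
  have x_comm: "K Q ** x = x ** K Q"
    by (simp add: x_def vec_eq_iff matrix_matrix_mult_def mat_def if_distrib if_distribR
        sum.delta sum.delta' mult.commute cong: if_cong)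
  have "x - K (Q ** A ** P) = K Q ** (x - K A) ** K P"
  proof -
    have "K Q ** (x - K A) ** K P = (K Q ** x) ** K P - K Q ** K A ** K P"
      by (simp add: vec_eq_iff matrix_matrix_mult_def sum_subtractf left_diff_distrib right_diff_distrib)
    also have "(K Q ** x) ** K P = x ** K (Q ** P)"
      by (simp only: x_comm K_mult matrix_mul_assoc)
    finally show ?thesis
      by (simp add: assms K_1 K_mult)
  qed
  then have "charpoly (Q ** A ** P) = det (K Q) * charpoly A * det (K P)"
    by (simp add: charpoly_K det_mul)
  also have "\<dots> = charpoly A * (det (K Q ** K P))"
    by (simp add: det_mul mult_ac)
  finally show ?thesis
    by (simp add: K_mult[symmetric] assms K_1)
qed

lemma charpoly_diagonal:
  "charpoly (\<chi> i j. if i = j then \<mu> i else 0 :: real^'n^'n) = (\<Prod>i\<in>UNIV. [:- \<mu> i, 1:])"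
  unfolding charpoly_def by (subst det_diagonal) auto

lemma orthonormal_matrix_square:
  fixes e :: "'n::finite \<Rightarrow> real^'n"
  assumes "\<And>i j. e i \<bullet> e j = (if i = j then 1 else 0)"
  shows "(\<chi> i. e i) ** transpose (\<chi> i. e i) = mat 1"
  using assms by (simp add: vec_eq_iff matrix_matrix_mult_def transpose_def mat_def inner_vec_def)

text \<open>
  A square matrix with orthonormal rows also has orthonormal columns, which
  expresses that the vectors span the whole space.
\<close>

lemma orthonormal_parseval:
  fixes e :: "'n::finite \<Rightarrow> real^'n"
  assumes "\<And>i j. e i \<bullet> e j = (if i = j then 1 else 0)"
  shows "x \<bullet> y = (\<Sum>i\<in>UNIV. (e i \<bullet> x) * (e i \<bullet> y))"
proof -
  let ?P = "\<chi> i. e i"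
  have "transpose ?P ** ?P = mat 1"
    using orthonormal_matrix_square[OF assms] matrix_left_right_inverse by blast
  then have "x \<bullet> y = x \<bullet> (transpose ?P *v (?P *v y))"
    by (simp add: matrix_vector_mul_assoc)
  also have "\<dots> = (?P *v x) \<bullet> (?P *v y)"
    by (metis dot_lmul_matrix vector_transpose_matrix)
  finally show ?thesis
    by (simp add: inner_vec_def[of "?P *v x"] matrix_vector_mul_component)
qed

text \<open>
  In an orthonormal eigenbasis the Gram matrix becomes diagonal, so its characteristic polynomial
  splits into linear factors and no eigenvalue is lost among the real roots.
\<close>

lemma singular_values_eigenbasis:
  fixes D :: "real^'n^'n" and e :: "'n \<Rightarrow> real^'n"
  assumes orth: "\<And>i j. e i \<bullet> e j = (if i = j then 1 else 0)"
    and eig: "\<And>i. (transpose D ** D) *v e i = \<mu> i *\<^sub>R e i"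
  shows "mset (singular_values D) = image_mset (\<lambda>i. sqrt (\<mu> i)) (mset_set UNIV)"
proof -
  let ?A = "transpose D ** D" and ?P = "\<chi> i. e i"
  have "(?P ** ?A ** transpose ?P) $ i $ j = e i \<bullet> (?A *v e j)" for i j
  proof -
    have "(?P ** ?A ** transpose ?P) $ i $ j = (?P ** (?A ** transpose ?P)) $ i $ j"
      by (simp add: matrix_mul_assoc)
    also have "\<dots> = e i \<bullet> (?A *v e j)"
      by (simp add: matrix_matrix_mult_def[of ?P] matrix_matrix_mult_def[of ?A] transpose_def[of ?P] inner_vec_def matrix_vector_mult_def)
    finally show ?thesis .
  qed
  then have "?P ** ?A ** transpose ?P = (\<chi> i j. if i = j then \<mu> i else 0)"
    by (simp add: vec_eq_iff eig orth)
  then have "charpoly ?A = (\<Prod>i\<in>UNIV. [:- \<mu> i, 1:])"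
    using charpoly_similar[OF orthonormal_matrix_square[OF orth], of ?A] by (simp add: charpoly_diagonal)
  then have "proots (charpoly ?A) = (\<Sum>i\<in>UNIV. {#\<mu> i#})"
    by (simp add: proots_prod)
  also have "\<dots> = image_mset \<mu> (mset_set UNIV)"
    by (simp add: sum_unfold_sum_mset)
  finally show ?thesis
    by (simp add: singular_values_def multiset.map_comp o_def)
qed

section \<open>The operator norm criterion\<close>

text \<open>
  With \<open>z\<close> measured from the midpoint, the two squared distances are a common term minus and plus
  \<open>d \<bullet> z\<close>; the product is a difference of two squares.
\<close>

lemma product_of_squares_centered:
  fixes x p q :: "'a::real_inner"
  defines "z \<equiv> x - (1/2) *\<^sub>R (p + q)" and "d \<equiv> p - q"
  shows "((x - p) \<bullet> (x - p)) * ((x - q) \<bullet> (x - q)) = (z \<bullet> z + d \<bullet> d / 4)\<^sup>2 - (d \<bullet> z)\<^sup>2"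
proof -
  have xp: "x - p = z - (1/2) *\<^sub>R d" and xq: "x - q = z + (1/2) *\<^sub>R d"
    by (simp_all add: z_def d_def algebra_simps scaleR_add_left[symmetric])
  have factors: "(x - p) \<bullet> (x - p) = (z \<bullet> z + d \<bullet> d / 4) - d \<bullet> z"
    "(x - q) \<bullet> (x - q) = (z \<bullet> z + d \<bullet> d / 4) + d \<bullet> z"
    unfolding xp xq
    by (simp_all add: inner_diff_left inner_diff_right inner_add_left inner_add_right inner_commute[of z d] field_simps)
  show ?thesis
    unfolding factors by (simp add: power2_eq_square algebra_simps)
qed

text \<open>
  For \<open>Z = W\<close> this is the trace of the square of \<open>D ** transpose Z\<close>.  It is kept as a form in two
  arguments so that bilinearity can be expressed.
\<close>

definition cross_form :: "real^'n^'n \<Rightarrow> real^'n^'n \<Rightarrow> real^'n^'n \<Rightarrow> real" where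
  "cross_form D Z W = (\<Sum>i\<in>UNIV. \<Sum>k\<in>UNIV. (D $ i \<bullet> Z $ k) * (D $ k \<bullet> W $ i))"

lemma bilinear_cross_form: "bilinear (cross_form D)"
  unfolding bilinear_def linear_iff cross_form_def
  by (simp add: inner_add_right distrib_left distrib_right sum.distrib sum_distrib_left mult_ac)

text \<open>
  The pairing of the minors of order two of \<open>D\<close> and \<open>Z\<close> (each unordered pair counted with
  multiplicity).  It trades the square \<open>(D \<bullet> Z)\<^sup>2\<close> for \<open>cross_form D Z Z\<close>
  at the price of minors of \<open>Z\<close>, which are free in a polyconvex function.
\<close>

lemma minor_pairing:
  fixes D Z :: "real^'n^'n"
  shows "(\<Sum>i\<in>UNIV. \<Sum>k\<in>UNIV. \<Sum>j\<in>UNIV. \<Sum>l\<in>UNIV.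
      D $ i $ j * D $ k $ l * (Z $ i $ j * Z $ k $ l - Z $ i $ l * Z $ k $ j))
    = (D \<bullet> Z)\<^sup>2 - cross_form D Z Z"
proof -
  have "(D \<bullet> Z)\<^sup>2 = (\<Sum>i\<in>UNIV. \<Sum>k\<in>UNIV. (D $ i \<bullet> Z $ i) * (D $ k \<bullet> Z $ k))"
    by (simp add: inner_vec_def[of D] power2_eq_square sum_product)
  then show ?thesis
    unfolding cross_form_def
    by (simp add: inner_vec_def sum_product sum_subtractf[symmetric] algebra_simps)
qed

text \<open>
  The trace of \<open>M ** M\<close> is at most the squared Frobenius norm of \<open>M\<close>; here
  \<open>M = D ** transpose Z\<close>, whose columns are the images under \<open>D\<close> of the rows of \<open>Z\<close>.
\<close>

lemma cross_form_le_operator: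
  fixes D Z :: "real^'n^'n"
  shows "cross_form D Z Z \<le> (\<Sum>k\<in>UNIV. (D *v Z $ k) \<bullet> (D *v Z $ k))"
proof -
  let ?S = "\<Sum>i\<in>UNIV. \<Sum>k\<in>UNIV. (D $ i \<bullet> Z $ k)\<^sup>2"
  have "cross_form D Z Z \<le> (\<Sum>i\<in>UNIV. \<Sum>k\<in>UNIV. ((D $ i \<bullet> Z $ k)\<^sup>2 + (D $ k \<bullet> Z $ i)\<^sup>2) / 2)"
    unfolding cross_form_def
  proof (intro sum_mono)
    fix i k
    show "(D $ i \<bullet> Z $ k) * (D $ k \<bullet> Z $ i) \<le> ((D $ i \<bullet> Z $ k)\<^sup>2 + (D $ k \<bullet> Z $ i)\<^sup>2) / 2"
      using sum_squares_bound[of "D $ i \<bullet> Z $ k" "D $ k \<bullet> Z $ i"] by simp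
  qed
  also have "\<dots> = (?S + (\<Sum>i\<in>UNIV. \<Sum>k\<in>UNIV. (D $ k \<bullet> Z $ i)\<^sup>2)) / 2"
    by (simp add: sum_divide_distrib[symmetric] sum.distrib)
  also have "(\<Sum>i\<in>UNIV. \<Sum>k\<in>UNIV. (D $ k \<bullet> Z $ i)\<^sup>2) = ?S"
    by (rule sum.swap)
  also have "(?S + ?S) / 2 = (\<Sum>k\<in>UNIV. \<Sum>i\<in>UNIV. (D $ i \<bullet> Z $ k)\<^sup>2)"
    using sum.swap[of "\<lambda>i k. (D $ i \<bullet> Z $ k)\<^sup>2" UNIV UNIV] by simp
  also have "\<dots> = (\<Sum>k\<in>UNIV. (D *v Z $ k) \<bullet> (D *v Z $ k))"
    by (simp add: inner_vec_def[of "D *v _"] matrix_vector_mul_component power2_eq_square)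
  finally show ?thesis .
qed

text \<open>
  With \<open>Z = X - C\<close> and \<open>s = D \<bullet> D\<close> the function equals
  \<open>(Z \<bullet> Z)\<^sup>2 + s\<^sup>2 / 16 + (s / 2 * (Z \<bullet> Z) - cross_form D Z Z) - ((D \<bullet> Z)\<^sup>2 - cross_form D Z Z)\<close>.
  The last bracket is a combination of minors by \<open>minor_pairing\<close>.  The quadratic form in the other
  bracket is nonnegative: apply the operator bound to each row of \<open>Z\<close>.
\<close>

lemma polyconvex_if_operator_bound:
  fixes D C :: "real^'n::{finite,linorder}^'n::{finite,linorder}"
  assumes bound: "\<And>v. 2 * ((D *v v) \<bullet> (D *v v)) \<le> (D \<bullet> D) * (v \<bullet> v)"
  shows "polyconvex (\<lambda>X. ((X - C) \<bullet> (X - C) + D \<bullet> D / 4)\<^sup>2 - (D \<bullet> (X - C))\<^sup>2)"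
proof -
  define s where "s = D \<bullet> D"
  have s0: "0 \<le> s" by (simp add: s_def)
  define B where "B Z W = s / 2 * (Z \<bullet> W) - cross_form D Z W" for Z W
  have "bilinear B"
    using bilinear_cross_form[of D] unfolding B_def bilinear_def linear_iff
    by (simp add: inner_add_left inner_add_right algebra_simps)
  moreover have "0 \<le> B Z Z" for Z
  proof -
    have "2 * cross_form D Z Z \<le> (\<Sum>k\<in>UNIV. 2 * ((D *v Z $ k) \<bullet> (D *v Z $ k)))"
      using cross_form_le_operator[of D Z] by (simp add: sum_distrib_left[symmetric])
    also have "\<dots> \<le> (\<Sum>k\<in>UNIV. s * (Z $ k \<bullet> Z $ k))"
      unfolding s_def by (intro sum_mono bound)
    also have "\<dots> = s * (Z \<bullet> Z)"
      by (simp add: inner_vec_def[of Z] sum_distrib_left)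
    finally show ?thesis
      by (simp add: B_def)
  qed
  ultimately have "convex_on UNIV (\<lambda>X. B (X - C) (X - C))"
    by (rule convex_on_bilinear_diagonal)
  moreover have "bilinear (inner :: _ \<Rightarrow> real^'n::{finite,linorder}^'n::{finite,linorder} \<Rightarrow> real)"
    by (simp add: bilinear_def linear_iff inner_add_left inner_add_right)
  then have "convex_on UNIV (\<lambda>X. ((X - C) \<bullet> (X - C))\<^sup>2)"
    by (intro convex_on_power2_nonneg convex_on_bilinear_diagonal[of inner]) auto
  ultimately have "convex_on UNIV (\<lambda>X. ((X - C) \<bullet> (X - C))\<^sup>2 + B (X - C) (X - C))"
    by (intro convex_on_add)
  then have "polyconvex (\<lambda>X. (((X - C) \<bullet> (X - C))\<^sup>2 + B (X - C) (X - C))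
      + ((\<Sum>i\<in>UNIV. \<Sum>k\<in>UNIV. \<Sum>j\<in>UNIV. \<Sum>l\<in>UNIV. (- (D $ i $ j * D $ k $ l))
          * ((X - C) $ i $ j * (X - C) $ k $ l - (X - C) $ i $ l * (X - C) $ k $ j)) + s\<^sup>2 / 16))"
    by (intro polyconvex_add[OF convex_on_imp_polyconvex polyconvex_add[OF polyconvex_sum polyconvex_const]]
          polyconvex_sum polyconvex_two_by_two_translate)
  moreover have "((Z \<bullet> Z)\<^sup>2 + B Z Z)
      + ((\<Sum>i\<in>UNIV. \<Sum>k\<in>UNIV. \<Sum>j\<in>UNIV. \<Sum>l\<in>UNIV. (- (D $ i $ j * D $ k $ l))
          * (Z $ i $ j * Z $ k $ l - Z $ i $ l * Z $ k $ j)) + s\<^sup>2 / 16)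
      = (Z \<bullet> Z + s / 4)\<^sup>2 - (D \<bullet> Z)\<^sup>2" for Z
  proof -
    have "(\<Sum>i\<in>UNIV. \<Sum>k\<in>UNIV. \<Sum>j\<in>UNIV. \<Sum>l\<in>UNIV. (- (D $ i $ j * D $ k $ l))
          * (Z $ i $ j * Z $ k $ l - Z $ i $ l * Z $ k $ j)) = cross_form D Z Z - (D \<bullet> Z)\<^sup>2"
      using minor_pairing[of D Z] by (simp only: mult_minus_left sum_negf)
    then show ?thesis
      by (simp only: B_def) (simp add: power2_eq_square field_simps)
  qed
  ultimately show ?thesis
    by (simp only: s_def)
qed

text \<open>
  Rank-one convexity is tested at the midpoint \<open>C\<close> in the directions \<open>(D v) v\<^sup>T\<close>, which
  make the inner product with \<open>D\<close> as large as possible relative to their norm when \<open>v\<close> is a leading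
  singular vector.  As the length \<open>t\<close> of the step tends to zero, the terms of second order give the
  claim.
\<close>

lemma operator_bound_if_polyconvex:
  fixes D C :: "real^'n::{finite,linorder}^'n::{finite,linorder}"
  assumes poly: "polyconvex (\<lambda>X. ((X - C) \<bullet> (X - C) + D \<bullet> D / 4)\<^sup>2 - (D \<bullet> (X - C))\<^sup>2)"
  shows "2 * ((D *v v) \<bullet> (D *v v)) \<le> (D \<bullet> D) * (v \<bullet> v)"
proof (cases "D *v v = 0")
  case False
  define s w m where "s = D \<bullet> D" and "w = (D *v v) \<bullet> (D *v v)" and "m = v \<bullet> v"
  have "w > 0" using False by (simp add: w_def)
  have "v \<noteq> 0" using False by auto
  then have "m > 0" by (simp add: m_def)
  have step: "w \<le> m * s / 2 + t\<^sup>2 * (w * m\<^sup>2)" if "t \<noteq> 0" for t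
  proof -
    define R where "R = (\<chi> i j. (t *\<^sub>R (D *v v)) $ i * v $ j)"
    have RR: "R \<bullet> R = t\<^sup>2 * (w * m)"
      by (simp add: R_def w_def m_def inner_vec_def sum_product power2_eq_square sum_distrib_left mult_ac)
    have DR: "D \<bullet> R = t * w"
      by (simp add: R_def w_def inner_vec_def matrix_vector_mult_def sum_distrib_left sum_distrib_right mult_ac)
    have "2 * (s / 4)\<^sup>2 \<le> 2 * ((R \<bullet> R + s / 4)\<^sup>2 - (D \<bullet> R)\<^sup>2)"
      using polyconvex_rank_one_midpoint[OF poly, of C "t *\<^sub>R (D *v v)" v, folded R_def]
      by (simp add: s_def)
    then have "0 \<le> (t\<^sup>2 * w) * (m * s / 2 + t\<^sup>2 * (w * m\<^sup>2) - w)"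
      unfolding RR DR by (simp add: power2_eq_square algebra_simps)
    moreover have "t\<^sup>2 * w > 0"
      using that \<open>w > 0\<close> by simp
    ultimately show ?thesis
      by (simp add: zero_le_mult_iff)
  qed
  have "w \<le> m * s / 2"
  proof (rule field_le_epsilon)
    fix \<epsilon> :: real assume "\<epsilon> > 0"
    then show "w \<le> m * s / 2 + \<epsilon>"
      \<comment> \<open>The step length for which the error term is exactly \<open>\<epsilon>\<close>.\<close>
      using step[of "sqrt (\<epsilon> / (w * m\<^sup>2))"] \<open>w > 0\<close> \<open>m > 0\<close> by simp
  qed
  then show ?thesis
    by (simp add: s_def w_def m_def mult.commute)
qed simp

section \<open>Singular values\<close>

text \<open>
  The eigenvalues \<open>\<mu> i\<close> of the Gram matrix are the squared singular values.  Their sum is the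
  squared Frobenius norm of \<open>D\<close>, and the largest of them is the squared operator norm.
\<close>

lemma operator_bound_iff_singular_values:
  fixes D :: "real^'n^'n"
  defines "\<sigma> \<equiv> \<lambda>i. singular_values D ! (i - 1)"
  shows "(\<forall>v. 2 * ((D *v v) \<bullet> (D *v v)) \<le> (D \<bullet> D) * (v \<bullet> v))
    \<longleftrightarrow> 2 * (\<sigma> 1)\<^sup>2 \<le> (\<Sum>i = 1..CARD('n). (\<sigma> i)\<^sup>2)"
proof -
  let ?A = "transpose D ** D" and ?L = "singular_values D"
  have "transpose ?A = ?A"
    by (simp add: matrix_transpose_mul)
  then obtain e :: "'n \<Rightarrow> real^'n" and \<mu> where orth: "\<And>i j. e i \<bullet> e j = (if i = j then 1 else 0)"
      and eig: "\<And>i. ?A *v e i = \<mu> i *\<^sub>R e i"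
    by (rule symmetric_orthonormal_eigenbasis) blast
  have adj: "(D *v x) \<bullet> (D *v y) = (?A *v x) \<bullet> y" for x y
    using dot_lmul_matrix[of "D *v x" D y] transpose_matrix_vector[of D "D *v x"]
    by (simp add: matrix_vector_mul_assoc)
  have \<mu>: "\<mu> i = (D *v e i) \<bullet> (D *v e i)" for i
    by (simp add: adj eig orth)
  have expand: "(D *v v) \<bullet> (D *v v) = (\<Sum>i\<in>UNIV. \<mu> i * (e i \<bullet> v)\<^sup>2)" for v
  proof -
    have "e i \<bullet> (?A *v v) = \<mu> i * (e i \<bullet> v)" for i
      using adj[of v "e i"] adj[of "e i" v] by (simp add: eig inner_commute)
    then show ?thesis
      using orthonormal_parseval[OF orth, of "?A *v v" v]
      by (simp add: adj power2_eq_square mult_ac)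
  qed
  have sum_\<mu>: "(\<Sum>i\<in>UNIV. \<mu> i) = D \<bullet> D"
  proof -
    have "(\<Sum>i\<in>UNIV. \<mu> i) = (\<Sum>i\<in>UNIV. \<Sum>k\<in>UNIV. (e i \<bullet> D $ k) * (e i \<bullet> D $ k))"
      unfolding \<mu> inner_vec_def[of "D *v _"] by (simp add: matrix_vector_mul_component inner_commute)
    also have "\<dots> = (\<Sum>k\<in>UNIV. D $ k \<bullet> D $ k)"
      by (subst sum.swap) (simp add: orthonormal_parseval[OF orth, symmetric])
    finally show ?thesis
      by (simp add: inner_vec_def[of D])
  qed
  \<comment> \<open>Expansion of \<open>v\<close> in the eigenbasis turns the operator bound into one bound for each eigenvalue.\<close>
  have operator: "(\<forall>v. 2 * ((D *v v) \<bullet> (D *v v)) \<le> (D \<bullet> D) * (v \<bullet> v)) \<longleftrightarrow> (\<forall>i. 2 * \<mu> i \<le> D \<bullet> D)"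
  proof safe
    fix i assume "\<forall>v. 2 * ((D *v v) \<bullet> (D *v v)) \<le> (D \<bullet> D) * (v \<bullet> v)"
    then have "2 * ((D *v e i) \<bullet> (D *v e i)) \<le> (D \<bullet> D) * (e i \<bullet> e i)"
      by blast
    then show "2 * \<mu> i \<le> D \<bullet> D"
      by (simp add: \<mu> orth)
  next
    fix v assume le: "\<forall>i. 2 * \<mu> i \<le> D \<bullet> D"
    have "2 * ((D *v v) \<bullet> (D *v v)) = (\<Sum>i\<in>UNIV. (2 * \<mu> i) * (e i \<bullet> v)\<^sup>2)"
      by (simp add: expand sum_distrib_left mult_ac)
    also have "\<dots> \<le> (\<Sum>i\<in>UNIV. (D \<bullet> D) * (e i \<bullet> v)\<^sup>2)"
      using le by (intro sum_mono mult_right_mono) auto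
    also have "\<dots> = (D \<bullet> D) * (v \<bullet> v)"
      by (simp add: orthonormal_parseval[OF orth, of v v] sum_distrib_left power2_eq_square)
    finally show "2 * ((D *v v) \<bullet> (D *v v)) \<le> (D \<bullet> D) * (v \<bullet> v)" .
  qed
  have L: "mset ?L = image_mset (\<lambda>i. sqrt (\<mu> i)) (mset_set UNIV)"
    by (rule singular_values_eigenbasis[OF orth eig])
  have "\<mu> i \<ge> 0" for i
    by (simp add: \<mu>)
  have len: "length ?L = CARD('n)"
    using arg_cong[OF L, of size] by simp
  have set_L: "set ?L = range (\<lambda>i. sqrt (\<mu> i))"
    using arg_cong[OF L, of set_mset] by simp
  have "(\<Sum>i = 1..CARD('n). (\<sigma> i)\<^sup>2) = (\<Sum>i<CARD('n). (?L ! i)\<^sup>2)"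
    unfolding \<sigma>_def by (rule sum.reindex_bij_witness[of _ Suc "\<lambda>i. i - 1"]) auto
  also have "\<dots> = sum_list (map power2 ?L)"
    by (simp add: sum_list_sum_nth len atLeast0LessThan)
  also have "\<dots> = sum_mset (image_mset power2 (mset ?L))"
    by (simp flip: sum_mset_sum_list)
  also have "\<dots> = (\<Sum>i\<in>UNIV. \<mu> i)"
    using \<open>\<And>i. \<mu> i \<ge> 0\<close> by (simp add: L multiset.map_comp o_def sum_unfold_sum_mset)
  finally have sum_\<sigma>: "(\<Sum>i = 1..CARD('n). (\<sigma> i)\<^sup>2) = D \<bullet> D"
    by (simp add: sum_\<mu>)
  have "?L \<noteq> []"
    using len by auto
  then have "\<sigma> 1 \<in> set ?L"
    by (simp add: \<sigma>_def)
  then obtain i where i: "\<sigma> 1 = sqrt (\<mu> i)"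
    using set_L by auto
  have "sorted_wrt (\<ge>) ?L"
    by (simp add: singular_values_def sorted_wrt_rev)
  then have "x \<le> ?L ! 0" if "x \<in> set ?L" for x
    using that \<open>?L \<noteq> []\<close> by (cases ?L) auto
  then have "sqrt (\<mu> j) \<le> \<sigma> 1" for j
    by (simp add: \<sigma>_def set_L)
  then have "\<mu> j \<le> \<mu> i" for j
    by (simp only: i real_sqrt_le_iff)
  then have "(\<forall>j. 2 * \<mu> j \<le> D \<bullet> D) \<longleftrightarrow> 2 * \<mu> i \<le> D \<bullet> D"
    by (smt (verit))
  also have "\<mu> i = (\<sigma> 1)\<^sup>2"
    unfolding i using \<open>\<And>i. \<mu> i \<ge> 0\<close> by simp
  finally show ?thesis
    unfolding operator sum_\<sigma> .
qed

theorem theorem1: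
  fixes X1 X2 :: "real^'n::{finite,linorder}^'n::{finite,linorder}"
  assumes "CARD('n) \<ge> 2"
  defines "f \<equiv> \<lambda>X. frobenius_sq (X - X1) * frobenius_sq (X - X2)"
  defines "\<sigma> \<equiv> \<lambda>i. singular_values (X1 - X2) ! (i - 1)"
  shows "polyconvex f \<longleftrightarrow> (\<Sum>i = 1..CARD('n). (\<sigma> i)\<^sup>2) \<ge> 2 * (\<sigma> 1)\<^sup>2"
proof -
  define D C where "D = X1 - X2" and "C = (1/2) *\<^sub>R (X1 + X2)"
  have "f = (\<lambda>X. ((X - C) \<bullet> (X - C) + D \<bullet> D / 4)\<^sup>2 - (D \<bullet> (X - C))\<^sup>2)"
    unfolding f_def frobenius_sq_eq_inner D_def C_def by (simp only: product_of_squares_centered)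
  then have "polyconvex f \<longleftrightarrow> (\<forall>v. 2 * ((D *v v) \<bullet> (D *v v)) \<le> (D \<bullet> D) * (v \<bullet> v))"
    using polyconvex_if_operator_bound[of D C] operator_bound_if_polyconvex[of C D] by auto
  then show ?thesis
    unfolding \<sigma>_def D_def operator_bound_iff_singular_values .
qed

end
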